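(* Let $\alpha\in[0,1]$, $\delta\in(-1,\infty)$, and let $(G(t))_{t\ge 0}$ be the random graph process with parameters $\alpha,\delta$ described in the context. Let $\mathcal{C}_1(t)$ be the average local clustering coefficient of $G(t)$. Then $$\lim_{t\to\infty}\mathbb{P}\big(\mathcal{C}_1(t)\ge \alpha\,p(2)\big)=1,$$ where $$p(2)=\frac{A_1+\alpha}{(A_1+1)(2A_2+1)},\qquad A_\ell=\frac{[(\alpha+1)^2+\delta\alpha]+\delta(1+\alpha)(1-\alpha)/\ell}{(\alpha+1)[2(\alpha+1)+\delta]}\quad(\ell\ge1).$$
   Context: The model: $(G(t))_{t\in\mathbb{N}_0}$ is a random process of undirected simple graphs with vertex set $V_t=\{v_1,\dots,v_{t+2}\}$ and edge set $E_t$. $G(0)$ consists of two vertices $v_1,v_2$ joined by an edge. Given $G(0),\dots,G(t)$, the graph $G(t+1)$ is obtained from $G(t)$ by adding a new vertex $v_{t+3}$ and, with a choice between the two options made independently of the past: - with probability $1-\alpha$, joining $v_{t+3}$ by an edge to exactly one vertex of $V_t$, where $u\in V_t$ is chosen with (conditional) probability $\frac{d_t(u)+\delta}{2|E_t|+\delta(t+2)}$, $d_t(u)$ being the degree of $u$ in $G(t)$; - with probability $\alpha$, choosing an edge $\{u,v\}\in E_t$ uniformly at random and joining $v_{t+3}$ by edges to both $u$ and $v$ (so a triangle is created). Clustering: for $v\in V_t$, the local clustering coefficient is $C_t(v)=|E_t(v)|/\binom{d_t(v)}{2}$ if $d_t(v)\ge2$ and $C_t(v)=0$ otherwise, where $|E_t(v)|$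 is the number of edges of $G(t)$ between neighbours of $v$ (equivalently, the number of triangles of $G(t)$ containing $v$). The average local clustering coefficient of $G(t)$ is $\mathcal{C}_1(t)=\frac{1}{|V_t|}\sum_{i=1}^{|V_t|}C_t(v_i)$. *)

theory Defs
  imports "HOL-Probability.Probability"
begin

text \<open>
  A graph is the pair of its vertex set and its edge set, an edge being the two-element set of its
  endpoints. The vertex \<open>v\<^sub>i\<close> is the natural number \<open>i\<close>.
\<close>

type_synonym graph = "nat set \<times> nat set set"

abbreviation verts :: "graph \<Rightarrow> nat set" where "verts \<equiv> fst"
abbreviation edges :: "graph \<Rightarrow> nat set set" where "edges \<equiv> snd"

definition vdegree :: "graph \<Rightarrow> nat \<Rightarrow> nat" where
  "vdegree g v = card {e \<in> edges g. v \<in> e}"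

definition neighbours :: "graph \<Rightarrow> nat \<Rightarrow> nat set" where
  "neighbours g v = {u \<in> verts g. {u, v} \<in> edges g}"

definition local_clustering :: "graph \<Rightarrow> nat \<Rightarrow> real" where
  "local_clustering g v =
     (if vdegree g v \<ge> 2
      then real (card {e \<in> edges g. e \<subseteq> neighbours g v}) / real (vdegree g v choose 2)
      else 0)"

definition avg_local_clustering :: "graph \<Rightarrow> real" where
  "avg_local_clustering g = (\<Sum>v\<in>verts g. local_clustering g v) / real (card (verts g))"

definition initial_graph :: graph where
  "initial_graph = ({1, 2}, {{1, 2}})"

definition add_vertex :: "nat \<Rightarrow> nat set \<Rightarrow> graph \<Rightarrow> graph" where
  "add_vertex w S g = (insert w (verts g), edges g \<union> (\<lambda>u. {w, u}) ` S)"

text \<open>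
  On the graphs that occur in the process the weights below do form a probability distribution;
  see \<open>pmf_attachment\<close> and \<open>good_graph_step\<close>.
\<close>

definition attachment_pmf :: "real \<Rightarrow> nat \<Rightarrow> graph \<Rightarrow> nat pmf" where
  "attachment_pmf \<delta> t g = embed_pmf (\<lambda>u.
     if u \<in> verts g
     then (real (vdegree g u) + \<delta>) / (2 * real (card (edges g)) + \<delta> * (real t + 2))
     else 0)"

definition step_pmf :: "real \<Rightarrow> real \<Rightarrow> nat \<Rightarrow> graph \<Rightarrow> graph pmf" where
  "step_pmf \<alpha> \<delta> t g = bind_pmf (bernoulli_pmf \<alpha>) (\<lambda>triangle.
     if triangle
     then map_pmf (\<lambda>e. add_vertex (t + 3) e g) (pmf_of_set (edges g))
     else map_pmf (\<lambda>u. add_vertex (t + 3) {u} g) (attachment_pmf \<delta> t g))"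

text \<open>
  The process lives on an arbitrary probability space; its law is fixed by the conditional
  distribution of \<open>G (t + 1)\<close> given each history \<open>G 0, \<dots>, G t\<close> of positive probability.
\<close>

locale triangle_attachment_process = prob_space M for M :: "'w measure" +
  fixes \<alpha> \<delta> :: real and G :: "nat \<Rightarrow> 'w \<Rightarrow> graph"
  assumes measurable_G: "\<And>t. G t \<in> measurable M (count_space UNIV)"
    and G_0: "AE \<omega> in M. G 0 \<omega> = initial_graph"
    and G_Suc: "\<And>t h g.
      \<P>(\<omega> in M. \<forall>s\<le>t. G s \<omega> = h s) > 0 \<Longrightarrow>
      \<P>(\<omega> in M. G (Suc t) \<omega> = g \<bar> \<forall>s\<le>t. G s \<omega> = h s) = pmf (step_pmf \<alpha> \<delta> t (h t)) g"

definition A_coeff :: "real \<Rightarrow> real \<Rightarrow> nat \<Rightarrow> real" where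
  "A_coeff \<alpha> \<delta> l =
     (((\<alpha> + 1)\<^sup>2 + \<delta> * \<alpha>) + \<delta> * (1 + \<alpha>) * (1 - \<alpha>) / real l) /
     ((\<alpha> + 1) * (2 * (\<alpha> + 1) + \<delta>))"

definition p_two :: "real \<Rightarrow> real \<Rightarrow> real" where
  "p_two \<alpha> \<delta> =
     (A_coeff \<alpha> \<delta> 1 + \<alpha>) / ((A_coeff \<alpha> \<delta> 1 + 1) * (2 * A_coeff \<alpha> \<delta> 2 + 1))"

definition good_graph :: "nat \<Rightarrow> graph \<Rightarrow> bool" where
  "good_graph t g \<longleftrightarrow> verts g = {1..t + 2} \<and>
     (\<forall>e\<in>edges g. e \<subseteq> verts g \<and> card e = 2) \<and> (\<forall>v\<in>verts g. vdegree g v \<ge> 1)"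

lemma good_graphD:
  assumes "good_graph t g"
  shows "verts g = {1..t + 2}"
    and "e \<in> edges g \<Longrightarrow> e \<subseteq> verts g" and "e \<in> edges g \<Longrightarrow> card e = 2"
    and "v \<in> verts g \<Longrightarrow> vdegree g v \<ge> 1"
proof -
  note a = assms[unfolded good_graph_def]
  show "verts g = {1..t + 2}" by (rule conjunct1[OF a])
  show "e \<subseteq> verts g" if "e \<in> edges g"
    by (rule conjunct1[OF bspec[OF conjunct1[OF conjunct2[OF a]] that]])
  show "card e = 2" if "e \<in> edges g"
    by (rule conjunct2[OF bspec[OF conjunct1[OF conjunct2[OF a]] that]])
  show "vdegree g v \<ge> 1" if "v \<in> verts g"
    by (rule bspec[OF conjunct2[OF conjunct2[OF a]] that])
qed

lemma good_graph_initial: "good_graph 0 initial_graph"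
proof -
  have V: "{1..0 + 2} = {1, 2::nat}" by auto
  have D: "{e \<in> {{1, 2}}. v \<in> e} = {{1, 2}}" if "v \<in> {1, 2}" for v :: nat
    using that by blast
  have "card {e \<in> {{1, 2}}. v \<in> e} \<ge> 1" if "v \<in> {1, 2}" for v :: nat
    unfolding D[OF that] by simp
  thus ?thesis
    unfolding good_graph_def initial_graph_def vdegree_def fst_conv snd_conv V by simp
qed

lemma good_graph_finite_edges:
  assumes "good_graph t g"
  shows "finite (edges g)"
proof (rule finite_subset)
  show "edges g \<subseteq> Pow {1..t + 2}"
    using good_graphD(1,2)[OF assms] by blast
qed auto

lemma good_graph_edges_ne:
  assumes "good_graph t g"
  shows "edges g \<noteq> {}"
proof
  assume "edges g = {}"
  hence "vdegree g 1 = 0" by (simp add: vdegree_def)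
  moreover have "(1::nat) \<in> verts g" by (simp add: good_graphD(1)[OF assms])
  ultimately show False using good_graphD(4)[OF assms, of 1] by simp
qed

lemma handshake:
  assumes "good_graph t g"
  shows "(\<Sum>v\<in>verts g. vdegree g v) = 2 * card (edges g)"
proof -
  note fin = good_graph_finite_edges[OF assms]
  have fv: "finite (verts g)" using assms by (simp add: good_graph_def)
  have "(\<Sum>v\<in>verts g. vdegree g v) = (\<Sum>v\<in>verts g. \<Sum>e\<in>edges g. if v \<in> e then 1 else 0)"
    using fin by (simp add: vdegree_def sum.If_cases Int_def)
  also have "\<dots> = (\<Sum>e\<in>edges g. \<Sum>v\<in>verts g. if v \<in> e then 1 else 0)"
    by (rule sum.swap)
  also have "\<dots> = (\<Sum>e\<in>edges g. 2)"
  proof (rule sum.cong[OF refl])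
    fix e assume "e \<in> edges g"
    hence "verts g \<inter> e = e" "card e = 2" using good_graphD(2,3)[OF assms] by blast+
    thus "(\<Sum>v\<in>verts g. if v \<in> e then 1 else 0) = (2::nat)"
      using fv by (simp add: sum.If_cases)
  qed
  finally show ?thesis by simp
qed

lemma pmf_attachment:
  assumes g: "good_graph t g" and \<delta>: "\<delta> > -1"
  shows "pmf (attachment_pmf \<delta> t g) u =
    (if u \<in> verts g
     then (real (vdegree g u) + \<delta>) / (2 * real (card (edges g)) + \<delta> * (real t + 2))
     else 0)"
proof -
  define D where "D = 2 * real (card (edges g)) + \<delta> * (real t + 2)"
  have fv: "finite (verts g)" and cv: "card (verts g) = t + 2"
    using g by (simp_all add: good_graph_def)
  have pos: "real (vdegree g v) + \<delta> > 0" if "v \<in> verts g" for v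
    using good_graphD(4)[OF g that] \<delta> by linarith
  have D: "(\<Sum>v\<in>verts g. real (vdegree g v) + \<delta>) = D"
    using handshake[OF g] cv
    by (simp add: sum.distrib D_def algebra_simps flip: of_nat_sum)
  have "D > 0"
    unfolding D[symmetric] using pos fv cv by (intro sum_pos) auto
  have "0 \<le> (real (vdegree g v) + \<delta>) / D" if "v \<in> verts g" for v
    using pos[OF that] \<open>D > 0\<close> by simp
  note [simp] = this
  have nonneg: "0 \<le> (if v \<in> verts g then (real (vdegree g v) + \<delta>) / D else 0)" for v
    by simp
  have "(\<integral>\<^sup>+v. ennreal (if v \<in> verts g then (real (vdegree g v) + \<delta>) / D else 0)
          \<partial>count_space UNIV)
      = (\<Sum>v\<in>verts g. ennreal (if v \<in> verts g then (real (vdegree g v) + \<delta>) / D else 0))"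
    using fv by (intro nn_integral_count_space') auto
  also have "\<dots> = ennreal (\<Sum>v\<in>verts g. (real (vdegree g v) + \<delta>) / D)"
    using nonneg by (subst sum_ennreal) auto
  also have "(\<Sum>v\<in>verts g. (real (vdegree g v) + \<delta>) / D) = 1"
    using D \<open>D > 0\<close> by (simp flip: sum_divide_distrib)
  finally show ?thesis
    unfolding attachment_pmf_def D_def[symmetric]
    by (subst pmf_embed_pmf) (use nonneg in auto)
qed

lemma good_graph_add_vertex:
  assumes g: "good_graph t g" and S: "S \<noteq> {}" "S \<subseteq> verts g"
  shows "good_graph (Suc t) (add_vertex (t + 3) S g)"
proof -
  let ?h = "add_vertex (t + 3) S g"
  have new: "t + 3 \<notin> verts g" using g by (simp add: good_graph_def)
  have V: "verts ?h = {1..Suc t + 2}"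
    using g by (auto simp: good_graph_def add_vertex_def)
  have E: "e \<subseteq> verts ?h \<and> card e = 2" if e: "e \<in> edges ?h" for e
  proof (cases "e \<in> edges g")
    case True
    thus ?thesis using good_graphD(2,3)[OF g, of e] by (auto simp: add_vertex_def)
  next
    case False
    then obtain u where "u \<in> S" "e = {t + 3, u}" using e by (auto simp: add_vertex_def)
    thus ?thesis using S new by (auto simp: add_vertex_def card_insert_if)
  qed
  have "edges ?h \<subseteq> Pow (verts ?h)" using E by blast
  hence finE: "finite (edges ?h)" using V by (metis finite_Pow_iff finite_atLeastAtMost finite_subset)
  have "vdegree ?h v \<ge> 1" if "v \<in> verts ?h" for v
  proof -
    have "\<exists>e. e \<in> edges ?h \<and> v \<in> e"
    proof (cases "v \<in> verts g")
      case True
      hence "card {e \<in> edges g. v \<in> e} \<noteq> 0" using good_graphD(4)[OF g, of v] unfolding vdegree_def by linarith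
      hence "{e \<in> edges g. v \<in> e} \<noteq> {}" by (metis card.empty)
      thus ?thesis by (auto simp: add_vertex_def)
    next
      case False
      hence "v = t + 3" using that by (simp add: add_vertex_def)
      thus ?thesis using S by (auto simp: add_vertex_def)
    qed
    thus ?thesis using finE by (auto simp: vdegree_def Suc_le_eq card_gt_0_iff)
  qed
  thus ?thesis using V E by (simp add: good_graph_def)
qed

lemma good_graph_step:
  assumes g: "good_graph t g" and \<delta>: "\<delta> > -1" and h: "h \<in> set_pmf (step_pmf \<alpha> \<delta> t g)"
  shows "good_graph (Suc t) h"
proof -
  have as: "set_pmf (attachment_pmf \<delta> t g) \<subseteq> verts g"
    using pmf_attachment[OF g \<delta>] by (auto simp: set_pmf_eq split: if_splits)
  have es: "set_pmf (pmf_of_set (edges g)) = edges g"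
    by (intro set_pmf_of_set good_graph_edges_ne[OF g] good_graph_finite_edges[OF g])
  have en: "e \<noteq> {} \<and> e \<subseteq> verts g" if "e \<in> edges g" for e
    using good_graphD(2,3)[OF g that] by auto
  have "\<exists>S. (S \<in> set_pmf (pmf_of_set (edges g)) \<or>
      (\<exists>u\<in>set_pmf (attachment_pmf \<delta> t g). S = {u})) \<and> h = add_vertex (t + 3) S g"
    using h unfolding step_pmf_def set_bind_pmf
    by (auto split: if_splits simp del: set_pmf_of_set)
  then obtain S where S: "S \<in> set_pmf (pmf_of_set (edges g)) \<or>
      (\<exists>u\<in>set_pmf (attachment_pmf \<delta> t g). S = {u})" and hS: "h = add_vertex (t + 3) S g"
    by (elim exE conjE)
  from S have "S \<noteq> {} \<and> S \<subseteq> verts g"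
  proof
    assume "S \<in> set_pmf (pmf_of_set (edges g))"
    thus ?thesis unfolding es by (rule en)
  next
    assume "\<exists>u\<in>set_pmf (attachment_pmf \<delta> t g). S = {u}"
    then obtain u where "u \<in> set_pmf (attachment_pmf \<delta> t g)" "S = {u}" by (elim bexE)
    with as show ?thesis by auto
  qed
  thus ?thesis unfolding hS using good_graph_add_vertex[OF g, of S] by simp
qed

end

theory Submission
  imports Defs "HOL-Real_Asymp.Real_Asymp"
begin

text \<open>
  Write \<open>n = t + 2\<close> for the number of vertices at time \<open>t\<close>. Let \<open>0 < \<alpha> < 1\<close>. Every vertex of degree two
  whose two neighbours are adjacent, an ear, has clustering coefficient one, so it is enough to show
  that with high probability there are at least \<open>\<alpha> * p_two \<alpha> \<delta> * n\<close> ears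
  (\<open>avg_local_clustering_ge_ears\<close>). A triangle step creates an ear, and an ear is lost only when it
  receives a new neighbour, which happens at rate about \<open>2 * A_coeff \<alpha> \<delta> 2 / t\<close>. The number of ears
  should thus grow at least like \<open>q * t\<close> where \<open>q = \<alpha> - 2 * A_coeff \<alpha> \<delta> 2 * q\<close>, and this \<open>q\<close> is
  strictly larger than \<open>\<alpha> * p_two \<alpha> \<delta>\<close> (\<open>p_two_less_ear_density\<close>): comparing
  \<open>q = \<alpha> / (1 + 2 * A_coeff \<alpha> \<delta> 2)\<close> with the definition of \<open>p_two\<close>, the claim is that
  \<open>(A_coeff \<alpha> \<delta> 1 + \<alpha>) / (A_coeff \<alpha> \<delta> 1 + 1) < 1\<close>.

  The heuristic is made precise by a second moment. The shortage of ears below \<open>q * t\<close> has a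
  restoring drift, disturbed only by the deviation of the number of edges from \<open>1 + (1 + \<alpha>) * t\<close>.
  This deviation is a martingale with bounded increments, hence of order \<open>sqrt t\<close>. So the squared
  shortage grows by \<open>O(sqrt t)\<close> per step in expectation (\<open>deficit_drift\<close>), its expectation is
  \<open>O(t powr (3/2))\<close> (\<open>expectation_deficit_sq\<close>), and by Markov's inequality a shortage of order \<open>t\<close>
  has vanishing probability (\<open>prob_few_ears_tendsto_0\<close>).

  At the endpoints there is no room between \<open>q\<close> and \<open>\<alpha> * p_two \<alpha> \<delta>\<close>. For \<open>\<alpha> = 0\<close> the bound is zero.
  For \<open>\<alpha> = 1\<close> it is \<open>1 / 2\<close> and holds almost surely from time one on: every vertex of degree \<open>d\<close> has
  clustering coefficient at least \<open>2 / d\<close>, the average degree is \<open>(4 * t + 2) / n < 4\<close>, and \<open>2 / d\<close> is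
  convex in \<open>d\<close> (\<open>avg_local_clustering_law_1\<close>).
\<close>

section \<open>The random attachment set\<close>

text \<open>
  The random set of old vertices that the new vertex is joined to. The estimates below are about
  this set, since all quantities of interest change in a way that is determined by it.
\<close>

definition target_pmf :: "real \<Rightarrow> real \<Rightarrow> nat \<Rightarrow> graph \<Rightarrow> nat set pmf" where
  "target_pmf \<alpha> \<delta> t g = bind_pmf (bernoulli_pmf \<alpha>) (\<lambda>triangle.
     if triangle then pmf_of_set (edges g) else map_pmf (\<lambda>u. {u}) (attachment_pmf \<delta> t g))"

lemma step_pmf_eq_map_target:
  "step_pmf \<alpha> \<delta> t g = map_pmf (\<lambda>S. add_vertex (t + 3) S g) (target_pmf \<alpha> \<delta> t g)"
  unfolding step_pmf_def target_pmf_def map_bind_pmf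
  by (intro bind_pmf_cong refl) (simp add: map_pmf_comp)

lemma set_target_pmf:
  assumes "good_graph t g" "\<delta> > -1" "S \<in> set_pmf (target_pmf \<alpha> \<delta> t g)"
  shows "S \<in> edges g \<or> (\<exists>u\<in>verts g. S = {u})"
proof -
  have "set_pmf (attachment_pmf \<delta> t g) \<subseteq> verts g"
    using pmf_attachment[OF assms(1,2)] by (auto simp: set_pmf_eq split: if_splits)
  moreover have "set_pmf (pmf_of_set (edges g)) = edges g"
    by (intro set_pmf_of_set good_graph_edges_ne[OF assms(1)] good_graph_finite_edges[OF assms(1)])
  ultimately show ?thesis
    using assms(3) unfolding target_pmf_def set_bind_pmf by (auto split: if_splits)
qed

lemma set_target_pmf_1:
  assumes "good_graph t g" "S \<in> set_pmf (target_pmf 1 \<delta> t g)"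
  shows "S \<in> edges g"
proof -
  have "set_pmf (bernoulli_pmf 1) \<subseteq> {True}"
    by (auto simp: set_pmf_eq)
      (metis (full_types) diff_self order_refl pmf_bernoulli_False zero_le_one)
  moreover have "set_pmf (pmf_of_set (edges g)) = edges g"
    by (intro set_pmf_of_set good_graph_edges_ne[OF assms(1)] good_graph_finite_edges[OF assms(1)])
  ultimately show ?thesis
    using assms(2) unfolding target_pmf_def set_bind_pmf by (auto split: if_splits)
qed

lemma target_pmf_support:
  assumes "good_graph t g" "\<delta> > -1" "S \<in> set_pmf (target_pmf \<alpha> \<delta> t g)"
  shows "S \<noteq> {}" "S \<subseteq> verts g" "finite S" "card S = 1 \<or> card S = 2"
proof -
  show a: "S \<noteq> {}" "S \<subseteq> verts g" "card S = 1 \<or> card S = 2"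
    using set_target_pmf[OF assms] good_graphD(2,3)[OF assms(1), of S] by auto
  show "finite S" using a(2) good_graphD(1)[OF assms(1)] by (simp add: finite_subset)
qed

text \<open>
  Only finitely many graphs can occur at a given time, so every function is integrable and every
  expectation is a finite sum.
\<close>

lemma finite_good_graphs: "finite {g. good_graph t g}"
proof (rule finite_subset)
  show "{g. good_graph t g} \<subseteq> {{1..t + 2}} \<times> Pow (Pow {1..t + 2})"
  proof
    fix g assume "g \<in> {g. good_graph t g}"
    hence g: "good_graph t g" by simp
    show "g \<in> {{1..t + 2}} \<times> Pow (Pow {1..t + 2})"
      using good_graphD(1,2)[OF g] by (cases g) auto
  qed
qed auto

lemma finite_set_target_pmf:
  assumes "good_graph t g" "\<delta> > -1"
  shows "finite (set_pmf (target_pmf \<alpha> \<delta> t g))"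
proof (rule finite_subset)
  show "set_pmf (target_pmf \<alpha> \<delta> t g) \<subseteq> Pow (verts g)"
    using target_pmf_support(2)[OF assms] by blast
qed (simp add: good_graphD(1)[OF assms(1)])

text \<open>
  Every degree is at least one; summing the degrees, respectively the attachment weights, gives
  lower bounds on the two denominators that are linear in time. They hold for every good graph, so the
  random number of edges never causes trouble in a denominator.
\<close>

lemma weight_bounds:
  assumes g: "good_graph t g"
  shows "real t + 2 \<le> 2 * real (card (edges g))"
    and "(1 + \<delta>) * (real t + 2) \<le> 2 * real (card (edges g)) + \<delta> * (real t + 2)"
proof -
  have "(\<Sum>v\<in>verts g. 1) \<le> (\<Sum>v\<in>verts g. vdegree g v)"
    by (intro sum_mono) (rule good_graphD(4)[OF g])
  hence "t + 2 \<le> 2 * card (edges g)"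
    unfolding handshake[OF g] by (simp add: good_graphD(1)[OF g])
  thus *: "real t + 2 \<le> 2 * real (card (edges g))" by linarith
  thus "(1 + \<delta>) * (real t + 2) \<le> 2 * real (card (edges g)) + \<delta> * (real t + 2)"
    by (simp add: algebra_simps)
qed

text \<open>
  The conditional probability that a given vertex of degree \<open>d\<close> receives a new neighbour.
\<close>

definition hit_rate :: "real \<Rightarrow> real \<Rightarrow> nat \<Rightarrow> graph \<Rightarrow> nat \<Rightarrow> real" where
  "hit_rate \<alpha> \<delta> t g d = \<alpha> * real d / real (card (edges g)) +
     (1 - \<alpha>) * (real d + \<delta>) / (2 * real (card (edges g)) + \<delta> * (real t + 2))"

lemma expectation_hit:
  assumes g: "good_graph t g" and \<delta>: "\<delta> > -1" and \<alpha>: "0 \<le> \<alpha>" "\<alpha> \<le> 1" and v: "v \<in> verts g"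
  shows "measure_pmf.expectation (target_pmf \<alpha> \<delta> t g) (\<lambda>S. of_bool (v \<in> S)) =
    hit_rate \<alpha> \<delta> t g (vdegree g v)"
proof -
  have "measure_pmf.expectation (pmf_of_set (edges g)) (\<lambda>S. of_bool (v \<in> S)) =
      (\<Sum>e\<in>edges g. of_bool (v \<in> e)) / real (card (edges g))"
    by (rule integral_pmf_of_set[OF good_graph_edges_ne[OF g] good_graph_finite_edges[OF g]])
  also have "(\<Sum>e\<in>edges g. of_bool (v \<in> e)) = real (vdegree g v)"
    using good_graph_finite_edges[OF g] by (simp add: vdegree_def Int_def)
  finally have e: "measure_pmf.expectation (pmf_of_set (edges g)) (\<lambda>S. of_bool (v \<in> S)) =
      real (vdegree g v) / real (card (edges g))" .
  have "measure_pmf.expectation (attachment_pmf \<delta> t g) (\<lambda>u. of_bool (v \<in> {u})) =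
      measure_pmf.expectation (attachment_pmf \<delta> t g) (indicator {v})"
    by (intro Bochner_Integration.integral_cong) (auto simp: indicator_def)
  also have "\<dots> = pmf (attachment_pmf \<delta> t g) v"
    by (simp add: measure_pmf_single)
  finally have a: "measure_pmf.expectation (attachment_pmf \<delta> t g) (\<lambda>u. of_bool (v \<in> {u})) =
      (real (vdegree g v) + \<delta>) / (2 * real (card (edges g)) + \<delta> * (real t + 2))"
    using v by (simp add: pmf_attachment[OF g \<delta>])
  have "finite (set_pmf (attachment_pmf \<delta> t g))"
    using pmf_attachment[OF g \<delta>] good_graphD(1)[OF g]
    by (auto simp: set_pmf_eq intro: finite_subset[of _ "verts g"])
  hence "measure_pmf.expectation (target_pmf \<alpha> \<delta> t g) (\<lambda>S. of_bool (v \<in> S)) =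
      (\<Sum>triangle\<in>UNIV. pmf (bernoulli_pmf \<alpha>) triangle *\<^sub>R measure_pmf.expectation
        (if triangle then pmf_of_set (edges g) else map_pmf (\<lambda>u. {u}) (attachment_pmf \<delta> t g))
        (\<lambda>S. of_bool (v \<in> S)) :: real)"
    unfolding target_pmf_def
    using good_graph_edges_ne[OF g] good_graph_finite_edges[OF g]
    by (subst pmf_expectation_bind[where A = UNIV]) auto
  thus ?thesis using \<alpha> e a by (simp add: UNIV_bool hit_rate_def)
qed

lemma expectation_card_hit:
  assumes g: "good_graph t g" and \<delta>: "\<delta> > -1" and \<alpha>: "0 \<le> \<alpha>" "\<alpha> \<le> 1" and A: "A \<subseteq> verts g"
  shows "measure_pmf.expectation (target_pmf \<alpha> \<delta> t g) (\<lambda>S. real (card (S \<inter> A))) =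
    (\<Sum>v\<in>A. hit_rate \<alpha> \<delta> t g (vdegree g v))"
proof -
  have fA: "finite A" using A good_graphD(1)[OF g] by (simp add: finite_subset)
  have "measure_pmf.expectation (target_pmf \<alpha> \<delta> t g) (\<lambda>S. real (card (S \<inter> A))) =
    measure_pmf.expectation (target_pmf \<alpha> \<delta> t g) (\<lambda>S. \<Sum>v\<in>A. of_bool (v \<in> S))"
    using fA by (simp add: Int_commute)
  also have "\<dots> = (\<Sum>v\<in>A. measure_pmf.expectation (target_pmf \<alpha> \<delta> t g) (\<lambda>S. of_bool (v \<in> S)))"
    by (intro Bochner_Integration.integral_sum integrable_measure_pmf_finite
        finite_set_target_pmf[OF g \<delta>])
  also have "\<dots> = (\<Sum>v\<in>A. hit_rate \<alpha> \<delta> t g (vdegree g v))"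
    using A by (intro sum.cong refl expectation_hit[OF g \<delta> \<alpha>]) auto
  finally show ?thesis .
qed

text \<open>
  Summing the hit rates over all vertices, by the handshake lemma; a triangle step hits two
  vertices and the other step one.
\<close>

lemma expectation_card_target:
  assumes g: "good_graph t g" and \<delta>: "\<delta> > -1" and \<alpha>: "0 \<le> \<alpha>" "\<alpha> \<le> 1"
  shows "measure_pmf.expectation (target_pmf \<alpha> \<delta> t g) (\<lambda>S. real (card S)) = 1 + \<alpha>"
proof -
  define E where "E = real (card (edges g))"
  define D where "D = 2 * E + \<delta> * (real t + 2)"
  have pos: "E > 0" "D > 0"
    using weight_bounds(1)[OF g] weight_bounds(2)[OF g, of \<delta>] \<delta> mult_pos_pos[of "1 + \<delta>" "real t + 2"]
    unfolding E_def D_def by linarith+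
  have cv: "real (card (verts g)) = real t + 2" by (simp add: good_graphD(1)[OF g])
  have hs: "(\<Sum>v\<in>verts g. real (vdegree g v)) = 2 * E"
    using handshake[OF g] by (simp add: E_def flip: of_nat_sum)
  have "measure_pmf.expectation (target_pmf \<alpha> \<delta> t g) (\<lambda>S. real (card S)) =
      measure_pmf.expectation (target_pmf \<alpha> \<delta> t g) (\<lambda>S. real (card (S \<inter> verts g)))"
    using target_pmf_support(2)[OF g \<delta>]
    by (intro integral_cong_AE) (auto simp: AE_measure_pmf_iff Int_absorb2)
  also have "\<dots> = (\<Sum>v\<in>verts g. \<alpha> / E * real (vdegree g v) + (1 - \<alpha>) / D * (real (vdegree g v) + \<delta>))"
    by (simp add: expectation_card_hit[OF g \<delta> \<alpha> subset_refl] hit_rate_def E_def D_def)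
  also have "\<dots> = \<alpha> / E * (2 * E) + (1 - \<alpha>) / D * D"
    unfolding sum.distrib
    by (simp only: hs cv D_def sum.distrib sum_constant mult.commute[of \<delta>]
        flip: sum_distrib_left)
  also have "\<dots> = 1 + \<alpha>" using pos by simp
  finally show ?thesis .
qed

section \<open>Reduction to the iterated step kernel\<close>

text \<open>
  The process is given on an abstract probability space through conditional distributions.
  All estimates are carried out for its one-dimensional marginals, which iterate the step kernel.
\<close>

primrec law :: "real \<Rightarrow> real \<Rightarrow> nat \<Rightarrow> graph pmf" where
  "law \<alpha> \<delta> 0 = return_pmf initial_graph"
| "law \<alpha> \<delta> (Suc t) = bind_pmf (law \<alpha> \<delta> t) (step_pmf \<alpha> \<delta> t)"

lemma good_graph_law:
  assumes "\<delta> > -1" "g \<in> set_pmf (law \<alpha> \<delta> t)"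
  shows "good_graph t g"
  using assms(2) by (induction t arbitrary: g)
    (auto simp: good_graph_initial intro: good_graph_step[OF _ assms(1)])

lemma finite_set_law:
  assumes "\<delta> > -1"
  shows "finite (set_pmf (law \<alpha> \<delta> t))"
  by (rule finite_subset[OF _ finite_good_graphs]) (use good_graph_law[OF assms] in blast)

context triangle_attachment_process
begin

lemma sets_G [measurable]: "{\<omega> \<in> space M. P (G t \<omega>)} \<in> events"
  using measurable_sets[OF measurable_G[of t], of "{g. P g}"]
  by (simp add: vimage_def Int_def conj_commute)

text \<open>
  The type of graphs is uncountable. Summation over histories is possible because almost surely
  each \<open>G s\<close> is one of the finitely many good graphs.
\<close>

lemma prob_decompose_history:
  assumes ae: "AE \<omega> in M. \<forall>s\<le>t. good_graph s (G s \<omega>)"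
    and Q: "{\<omega> \<in> space M. Q \<omega>} \<in> events"
  shows "\<P>(\<omega> in M. Q \<omega>) =
    (\<Sum>h\<in>(\<Pi>\<^sub>E s\<in>{..t}. {g. good_graph s g}). \<P>(\<omega> in M. Q \<omega> \<and> (\<forall>s\<le>t. G s \<omega> = h s)))"
proof (rule prob_sum)
  show "finite (\<Pi>\<^sub>E s\<in>{..t}. {g. good_graph s g})"
    by (intro finite_PiE finite_good_graphs) auto
  show "{\<omega> \<in> space M. Q \<omega> \<and> (\<forall>s\<le>t. G s \<omega> = h s)} \<in> events" for h
    using Q
    by (intro sets.sets_Collect_conj sets.sets_Collect_countable_All sets.sets_Collect_imp sets_G) auto
  show "AE \<omega> in M. (\<forall>h\<in>(\<Pi>\<^sub>E s\<in>{..t}. {g. good_graph s g}). Q \<omega> \<and> (\<forall>s\<le>t. G s \<omega> = h s) \<longrightarrow> Q \<omega>) \<and>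
      (Q \<omega> \<longrightarrow> (\<exists>!h. h \<in> (\<Pi>\<^sub>E s\<in>{..t}. {g. good_graph s g}) \<and> Q \<omega> \<and> (\<forall>s\<le>t. G s \<omega> = h s)))"
    using ae
  proof eventually_elim
    case (elim \<omega>)
    have "\<exists>!h. h \<in> (\<Pi>\<^sub>E s\<in>{..t}. {g. good_graph s g}) \<and> Q \<omega> \<and> (\<forall>s\<le>t. G s \<omega> = h s)" if "Q \<omega>"
    proof (rule ex1I[of _ "\<lambda>s\<in>{..t}. G s \<omega>"])
      show "h = (\<lambda>s\<in>{..t}. G s \<omega>)"
        if "h \<in> (\<Pi>\<^sub>E s\<in>{..t}. {g. good_graph s g}) \<and> Q \<omega> \<and> (\<forall>s\<le>t. G s \<omega> = h s)" for h
        using that by (auto intro!: ext simp: PiE_def extensional_def restrict_def)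
    qed (use elim that in auto)
    thus ?case by blast
  qed
qed (rule Q)

text \<open>
  The Markov property, which the assumption on the process only gives after conditioning on the
  whole past: the law of the next step depends on the history \<open>h\<close> only through \<open>h t\<close>, so the
  histories can be grouped by their last graph.
\<close>

lemma prob_Suc:
  assumes ae: "AE \<omega> in M. \<forall>s\<le>t. good_graph s (G s \<omega>)"
  shows "\<P>(\<omega> in M. G (Suc t) \<omega> = g) =
    (\<Sum>g'\<in>{g. good_graph t g}. \<P>(\<omega> in M. G t \<omega> = g') * pmf (step_pmf \<alpha> \<delta> t g') g)"
proof -
  define H where "H = (\<Pi>\<^sub>E s\<in>{..t}. {g. good_graph s g})"
  define w where "w h = \<P>(\<omega> in M. \<forall>s\<le>t. G s \<omega> = h s)" for h
  define q where "q g' = pmf (step_pmf \<alpha> \<delta> t g') g" for g'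
  have w0: "w h \<ge> 0" for h by (simp add: w_def)
  have next_G: "\<P>(\<omega> in M. G (Suc t) \<omega> = g \<and> (\<forall>s\<le>t. G s \<omega> = h s)) = w h * q (h t)" for h
  proof (cases "w h > 0")
    case True
    thus ?thesis using G_Suc[of t h g] by (simp add: cond_prob_def w_def q_def field_simps)
  next
    case False
    hence "w h = 0" using w0[of h] by linarith
    moreover have "\<P>(\<omega> in M. G (Suc t) \<omega> = g \<and> (\<forall>s\<le>t. G s \<omega> = h s)) \<le> w h"
      unfolding w_def
      by (intro finite_measure_mono sets.sets_Collect_countable_All sets.sets_Collect_imp sets_G) auto
    ultimately show ?thesis by (simp add: measure_le_0_iff)
  qed
  have now: "\<P>(\<omega> in M. G t \<omega> = g' \<and> (\<forall>s\<le>t. G s \<omega> = h s)) = of_bool (h t = g') * w h" for g' h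
  proof (cases "h t = g'")
    case True
    thus ?thesis unfolding w_def by (auto intro!: arg_cong[where f = "measure M"])
  next
    case False
    hence "{\<omega> \<in> space M. G t \<omega> = g' \<and> (\<forall>s\<le>t. G s \<omega> = h s)} = {}" by auto
    thus ?thesis using False by (simp only: measure_empty) simp
  qed
  have fin: "finite {g. good_graph t g}" by (rule finite_good_graphs)
  have "\<P>(\<omega> in M. G (Suc t) \<omega> = g) = (\<Sum>h\<in>H. w h * q (h t))"
    by (subst prob_decompose_history[OF ae sets_G]) (simp add: H_def next_G)
  also have "\<dots> = (\<Sum>h\<in>H. \<Sum>g'\<in>{g. good_graph t g}. of_bool (h t = g') * w h * q g')"
  proof (intro sum.cong refl)
    fix h assume "h \<in> H"
    hence ht: "h t \<in> {g. good_graph t g}" by (auto simp: H_def PiE_def Pi_def)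
    have "(\<Sum>g'\<in>{g. good_graph t g}. of_bool (h t = g') * w h * q g') =
        (\<Sum>g'\<in>{g. good_graph t g}. if h t = g' then w h * q g' else 0)"
      by (intro sum.cong) auto
    thus "w h * q (h t) = (\<Sum>g'\<in>{g. good_graph t g}. of_bool (h t = g') * w h * q g')"
      using ht fin by simp
  qed
  also have "\<dots> = (\<Sum>g'\<in>{g. good_graph t g}. (\<Sum>h\<in>H. of_bool (h t = g') * w h) * q g')"
    by (subst sum.swap) (simp add: sum_distrib_right)
  also have "\<dots> = (\<Sum>g'\<in>{g. good_graph t g}. \<P>(\<omega> in M. G t \<omega> = g') * q g')"
    by (subst prob_decompose_history[OF ae sets_G]) (simp add: H_def now)
  finally show ?thesis by (simp add: q_def)
qed

text \<open>
  The two claims need each other: the recursion for the point masses presupposes that the past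
  consists of good graphs, and the next graph is good almost surely because the point masses at
  good graphs add up to one.
\<close>

lemma good_graph_G_and_prob_G_eq:
  assumes \<delta>: "\<delta> > -1"
  shows "(AE \<omega> in M. \<forall>s\<le>t. good_graph s (G s \<omega>)) \<and> (\<forall>g. \<P>(\<omega> in M. G t \<omega> = g) = pmf (law \<alpha> \<delta> t) g)"
proof (induction t)
  case 0
  have "\<P>(\<omega> in M. G 0 \<omega> = g) = pmf (law \<alpha> \<delta> 0) g" for g
  proof (cases "g = initial_graph")
    case True
    thus ?thesis using G_0 by (simp add: prob_Collect_eq_1)
  next
    case False
    have "AE \<omega> in M. \<not> G 0 \<omega> = g" using G_0 by eventually_elim (use False in auto)
    thus ?thesis using False by (simp add: prob_Collect_eq_0)
  qed
  moreover have "AE \<omega> in M. \<forall>s\<le>0. good_graph s (G s \<omega>)"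
    using G_0 by eventually_elim (simp add: good_graph_initial)
  ultimately show ?case by blast
next
  case (Suc t)
  hence ae: "AE \<omega> in M. \<forall>s\<le>t. good_graph s (G s \<omega>)"
    and p: "\<And>g. \<P>(\<omega> in M. G t \<omega> = g) = pmf (law \<alpha> \<delta> t) g" by auto
  have eq: "\<P>(\<omega> in M. G (Suc t) \<omega> = g) = pmf (law \<alpha> \<delta> (Suc t)) g" for g
    using good_graph_law[OF \<delta>]
    by (simp add: prob_Suc[OF ae] p pmf_bind integral_measure_pmf_real[OF finite_good_graphs[of t]] mult.commute)
  have "\<P>(\<omega> in M. good_graph (Suc t) (G (Suc t) \<omega>)) =
      (\<Sum>g\<in>{g. good_graph (Suc t) g}. \<P>(\<omega> in M. G (Suc t) \<omega> = g))"
    by (intro prob_sum finite_good_graphs sets_G) auto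
  also have "\<dots> = 1"
    unfolding eq by (rule sum_pmf_eq_1[OF finite_good_graphs]) (use good_graph_law[OF \<delta>] in blast)
  finally have "AE \<omega> in M. good_graph (Suc t) (G (Suc t) \<omega>)"
    by (simp add: prob_Collect_eq_1)
  with ae have "AE \<omega> in M. \<forall>s\<le>Suc t. good_graph s (G s \<omega>)"
    by eventually_elim (auto simp: le_Suc_eq)
  with eq show ?case by blast
qed

lemma prob_G_law:
  assumes \<delta>: "\<delta> > -1"
  shows "\<P>(\<omega> in M. P (G t \<omega>)) = measure_pmf.prob (law \<alpha> \<delta> t) {g. P g}"
proof -
  note eq = good_graph_G_and_prob_G_eq[OF \<delta>, of t]
  have fin: "finite {g. good_graph t g \<and> P g}"
    using finite_good_graphs[of t] by (rule rev_finite_subset) auto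
  have "AE \<omega> in M. good_graph t (G t \<omega>)" using conjunct1[OF eq] by eventually_elim auto
  hence "AE \<omega> in M. (\<forall>g\<in>{g. good_graph t g \<and> P g}. G t \<omega> = g \<longrightarrow> P (G t \<omega>)) \<and>
      (P (G t \<omega>) \<longrightarrow> (\<exists>!g. g \<in> {g. good_graph t g \<and> P g} \<and> G t \<omega> = g))"
    by eventually_elim auto
  hence "\<P>(\<omega> in M. P (G t \<omega>)) = (\<Sum>g\<in>{g. good_graph t g \<and> P g}. \<P>(\<omega> in M. G t \<omega> = g))"
    by (intro prob_sum fin sets_G) auto
  also have "\<dots> = measure_pmf.prob (law \<alpha> \<delta> t) {g. good_graph t g \<and> P g}"
    unfolding measure_measure_pmf_finite[OF fin] using eq by (intro sum.cong refl) blast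
  also have "\<dots> = measure_pmf.prob (law \<alpha> \<delta> t) {g. P g}"
    using good_graph_law[OF \<delta>]
    by (intro measure_pmf.finite_measure_eq_AE) (auto simp: AE_measure_pmf_iff)
  finally show ?thesis .
qed

end

text \<open>
  The form in which the process enters all moment estimates: a bound on the conditional
  expectation given the present graph is averaged over the present law.
\<close>

lemma expectation_law_Suc_le:
  fixes \<phi> \<psi> :: "graph \<Rightarrow> real"
  assumes \<delta>: "\<delta> > -1"
    and step: "\<And>g. good_graph t g \<Longrightarrow>
      measure_pmf.expectation (target_pmf \<alpha> \<delta> t g) (\<lambda>S. \<phi> (add_vertex (t + 3) S g)) \<le> \<psi> g"
  shows "measure_pmf.expectation (law \<alpha> \<delta> (Suc t)) \<phi> \<le> measure_pmf.expectation (law \<alpha> \<delta> t) \<psi>"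
proof -
  let ?A = "{g. good_graph t g}"
  have "measure_pmf.expectation (law \<alpha> \<delta> (Suc t)) \<phi> =
      (\<Sum>g\<in>?A. pmf (law \<alpha> \<delta> t) g *\<^sub>R measure_pmf.expectation (step_pmf \<alpha> \<delta> t g) \<phi>)"
    unfolding law.simps using good_graph_law[OF \<delta>] finite_set_target_pmf[OF _ \<delta>]
    by (intro pmf_expectation_bind finite_good_graphs) (auto simp: step_pmf_eq_map_target)
  also have "\<dots> \<le> (\<Sum>g\<in>?A. \<psi> g * pmf (law \<alpha> \<delta> t) g)"
  proof (rule sum_mono)
    fix g assume "g \<in> ?A"
    hence "measure_pmf.expectation (step_pmf \<alpha> \<delta> t g) \<phi> \<le> \<psi> g"
      using step[of g] by (simp add: step_pmf_eq_map_target)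
    thus "pmf (law \<alpha> \<delta> t) g *\<^sub>R measure_pmf.expectation (step_pmf \<alpha> \<delta> t g) \<phi>
        \<le> \<psi> g * pmf (law \<alpha> \<delta> t) g"
      by (simp add: mult.commute[of "\<psi> g"] mult_left_mono)
  qed
  also have "\<dots> = measure_pmf.expectation (law \<alpha> \<delta> t) \<psi>"
    using good_graph_law[OF \<delta>] by (intro integral_measure_pmf_real[symmetric] finite_good_graphs) auto
  finally show ?thesis .
qed

section \<open>Ears and local clustering\<close>

lemma incident_edges_new:
  assumes "good_graph t g" "S \<subseteq> verts g"
  shows "{e \<in> edges (add_vertex (t + 3) S g). t + 3 \<in> e} = (\<lambda>u. {t + 3, u}) ` S"
proof -
  have "t + 3 \<notin> e" if "e \<in> edges g" for e
    using good_graphD(1)[OF assms(1)] good_graphD(2)[OF assms(1) that] by auto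
  thus ?thesis by (auto simp: add_vertex_def)
qed

lemma incident_edges_old:
  assumes "good_graph t g" "v \<in> verts g"
  shows "{e \<in> edges (add_vertex (t + 3) S g). v \<in> e} =
    {e \<in> edges g. v \<in> e} \<union> (if v \<in> S then {{t + 3, v}} else {})"
  using good_graphD(1)[OF assms(1)] assms(2) by (auto simp: add_vertex_def)

lemma card_spokes: "card ((\<lambda>u. {w, u}) ` S) = card S"
  by (intro card_image inj_onI) (auto simp: doubleton_eq_iff)

lemma vdegree_new:
  assumes "good_graph t g" "S \<subseteq> verts g"
  shows "vdegree (add_vertex (t + 3) S g) (t + 3) = card S"
  by (simp only: vdegree_def incident_edges_new[OF assms] card_spokes)

lemma vdegree_old:
  assumes "good_graph t g" "v \<in> verts g"
  shows "vdegree (add_vertex (t + 3) S g) v = vdegree g v + of_bool (v \<in> S)"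
proof -
  have "{t + 3, v} \<notin> edges g" using good_graphD(1,2)[OF assms(1)] by fastforce
  thus ?thesis
    using good_graph_finite_edges[OF assms(1)]
    by (simp add: vdegree_def incident_edges_old[OF assms])
qed

lemma card_edges_add_vertex:
  assumes "good_graph t g" "S \<subseteq> verts g"
  shows "card (edges (add_vertex (t + 3) S g)) = card (edges g) + card S"
proof -
  have "finite S" using assms good_graphD(1)[OF assms(1)] by (simp add: finite_subset)
  moreover have "edges g \<inter> (\<lambda>u. {t + 3, u}) ` S = {}"
    using good_graphD(1,2)[OF assms(1)] by fastforce
  ultimately show ?thesis
    using good_graph_finite_edges[OF assms(1)]
    by (simp add: add_vertex_def card_Un_disjoint card_spokes)
qed

text \<open>
  Vertices of degree two whose two neighbours are joined by an edge, that is, the ears of the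
  graph as they are glued to an edge by a triangle step. An edge \<open>S\<close> as required cannot contain
  \<open>v\<close>, since otherwise \<open>{v, v}\<close> would be an edge.
\<close>

definition ears :: "graph \<Rightarrow> nat set" where
  "ears g = {v \<in> verts g. \<exists>S\<in>edges g. {e \<in> edges g. v \<in> e} = (\<lambda>u. {v, u}) ` S}"

lemma ears_subset: "ears g \<subseteq> verts g"
  by (auto simp: ears_def)

lemma vdegree_ear:
  assumes "good_graph t g" "v \<in> ears g"
  shows "vdegree g v = 2"
proof -
  obtain S where "S \<in> edges g" "{e \<in> edges g. v \<in> e} = (\<lambda>u. {v, u}) ` S"
    using assms(2) by (auto simp: ears_def)
  thus ?thesis using good_graphD(3)[OF assms(1), of S] by (simp add: vdegree_def card_spokes)
qed

lemma finite_edges_subset: "good_graph t g \<Longrightarrow> finite {e \<in> edges g. P e}"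
  using good_graph_finite_edges[of t g] by simp

lemma local_clustering_ear:
  assumes g: "good_graph t g" and v: "v \<in> ears g"
  shows "local_clustering g v \<ge> 1"
proof -
  obtain S where S: "S \<in> edges g" "{e \<in> edges g. v \<in> e} = (\<lambda>u. {v, u}) ` S"
    using v by (auto simp: ears_def)
  have "u \<in> neighbours g v" if "u \<in> S" for u
  proof -
    have "{v, u} \<in> {e \<in> edges g. v \<in> e}" using S(2) that by blast
    thus ?thesis using good_graphD(2)[OF g S(1)] that by (auto simp: neighbours_def insert_commute)
  qed
  hence "S \<in> {e \<in> edges g. e \<subseteq> neighbours g v}" using S(1) by blast
  hence "card {e \<in> edges g. e \<subseteq> neighbours g v} > 0"
    using finite_edges_subset[OF g] by (auto simp: card_gt_0_iff)
  thus ?thesis by (simp add: local_clustering_def vdegree_ear[OF g v] choose_two)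
qed

lemma local_clustering_nonneg: "local_clustering g v \<ge> 0"
  by (simp add: local_clustering_def)

lemma avg_local_clustering_nonneg: "avg_local_clustering g \<ge> 0"
  by (simp add: avg_local_clustering_def sum_nonneg local_clustering_nonneg)

lemma avg_local_clustering_ge_ears:
  assumes "good_graph t g"
  shows "real (card (ears g)) / (real t + 2) \<le> avg_local_clustering g"
proof -
  have fin: "finite (verts g)" and cv: "card (verts g) = t + 2"
    using good_graphD(1)[OF assms] by simp_all
  have "real (card (ears g)) \<le> (\<Sum>v\<in>ears g. local_clustering g v)"
    using sum_mono[of "ears g" "\<lambda>_. 1" "local_clustering g"] local_clustering_ear[OF assms] by simp
  also have "\<dots> \<le> (\<Sum>v\<in>verts g. local_clustering g v)"
    by (intro sum_mono2 fin ears_subset local_clustering_nonneg)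
  finally show ?thesis
    by (simp add: avg_local_clustering_def cv divide_right_mono add.commute)
qed

lemma ears_add_vertex:
  assumes g: "good_graph t g" and S: "S \<subseteq> verts g"
  shows "ears g - S \<subseteq> ears (add_vertex (t + 3) S g)"
    and "S \<in> edges g \<Longrightarrow> t + 3 \<in> ears (add_vertex (t + 3) S g)"
proof -
  let ?h = "add_vertex (t + 3) S g"
  have E: "edges g \<subseteq> edges ?h" and V: "verts ?h = insert (t + 3) (verts g)"
    by (auto simp: add_vertex_def)
  show "t + 3 \<in> ears ?h" if "S \<in> edges g"
    using that E V incident_edges_new[OF g S] by (auto simp: ears_def)
  show "ears g - S \<subseteq> ears ?h"
  proof
    fix v assume "v \<in> ears g - S"
    hence v: "v \<in> verts g" "v \<notin> S" and "\<exists>R\<in>edges g. {e \<in> edges g. v \<in> e} = (\<lambda>u. {v, u}) ` R"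
      by (auto simp: ears_def)
    hence "\<exists>R\<in>edges ?h. {e \<in> edges ?h. v \<in> e} = (\<lambda>u. {v, u}) ` R"
      using E by (auto simp: incident_edges_old[OF g])
    thus "v \<in> ears ?h" using v V by (auto simp: ears_def)
  qed
qed

text \<open>
  A triangle step glues a new ear to its edge, and an ear can be lost only by being hit. Other
  ears may arise, for instance from a vertex of degree one on the chosen edge; only a lower bound
  is needed. Here \<open>card S - 1\<close> is the indicator of a triangle step.
\<close>

lemma card_ears_add_vertex:
  assumes g: "good_graph t g" and \<delta>: "\<delta> > -1" and S: "S \<in> set_pmf (target_pmf \<alpha> \<delta> t g)"
  shows "real (card (ears g)) + (real (card S) - 1) - real (card (S \<inter> ears g))
    \<le> real (card (ears (add_vertex (t + 3) S g)))"
proof -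
  let ?h = "add_vertex (t + 3) S g"
  note S' = target_pmf_support[OF g \<delta> S]
  have new: "t + 3 \<notin> verts g" using good_graphD(1)[OF g] by simp
  have fin: "finite (ears g)" "finite (ears ?h)"
    using good_graphD(1)[OF g] ears_subset[of g] ears_subset[of ?h]
    by (auto simp: add_vertex_def intro: finite_subset)
  have *: "card (ears g - S) = card (ears g) - card (S \<inter> ears g)" "card (S \<inter> ears g) \<le> card (ears g)"
    using fin by (simp_all add: card_Diff_subset_Int Int_commute card_mono)
  have "(\<exists>u. S = {u}) \<or> S \<in> edges g" using set_target_pmf[OF g \<delta> S] by auto
  thus ?thesis
  proof
    assume "\<exists>u. S = {u}"
    hence "card S = 1" by auto
    thus ?thesis using * card_mono[OF fin(2) ears_add_vertex(1)[OF g S'(2)]] by linarith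
  next
    assume e: "S \<in> edges g"
    have "card (insert (t + 3) (ears g - S)) \<le> card (ears ?h)"
      using ears_add_vertex[OF g S'(2)] e by (intro card_mono fin) auto
    moreover have "t + 3 \<notin> ears g - S" using new ears_subset[of g] by auto
    ultimately show ?thesis using * fin good_graphD(3)[OF g e] by simp
  qed
qed

section \<open>Triangle steps only\<close>

text \<open>
  With triangle steps only, a vertex that is hit gains one neighbour and at least one triangle, so
  the neighbourhood of a vertex of degree \<open>d\<close> spans at least \<open>d - 1\<close> edges. The second conjunct
  carries the induction that excludes degree one after the first step: only a vertex that lies on
  all edges, and is therefore certain to be hit next, may have smaller degree.
\<close>

definition triangle_rich :: "graph \<Rightarrow> bool" where
  "triangle_rich g \<longleftrightarrow> (\<forall>v\<in>verts g.
     vdegree g v \<le> Suc (card {e \<in> edges g. e \<subseteq> neighbours g v}) \<and>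
     (2 \<le> vdegree g v \<or> (\<forall>e\<in>edges g. v \<in> e)))"

lemma triangle_rich_add_vertex:
  assumes g: "good_graph t g" and w: "triangle_rich g" and S: "S \<in> edges g"
  shows "triangle_rich (add_vertex (t + 3) S g)"
  unfolding triangle_rich_def
proof
  let ?h = "add_vertex (t + 3) S g"
  let ?T = "\<lambda>g v. {e \<in> edges g. e \<subseteq> neighbours g v}"
  note S' = good_graphD(2,3)[OF g S]
  have "good_graph (Suc t) ?h" using S' by (intro good_graph_add_vertex[OF g]) auto
  hence fin: "finite (?T ?h v)" for v by (rule finite_edges_subset)
  fix v assume "v \<in> verts ?h"
  then consider "v = t + 3" | "v \<in> verts g" by (auto simp: add_vertex_def)
  thus "vdegree ?h v \<le> Suc (card (?T ?h v)) \<and> (2 \<le> vdegree ?h v \<or> (\<forall>e\<in>edges ?h. v \<in> e))"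
  proof cases
    case 1
    have "S \<in> ?T ?h v"
      using S S'(1) 1 by (auto simp: add_vertex_def neighbours_def insert_commute)
    hence "card (?T ?h v) > 0" using fin[of v] by (auto simp: card_gt_0_iff)
    thus ?thesis unfolding 1 using vdegree_new[OF g S'(1)] S'(2) by simp
  next
    case 2
    have inv: "vdegree g v \<le> Suc (card (?T g v))" "2 \<le> vdegree g v \<or> (\<forall>e\<in>edges g. v \<in> e)"
      using w 2 by (auto simp: triangle_rich_def)
    have sub: "?T g v \<subseteq> ?T ?h v" by (auto simp: add_vertex_def neighbours_def)
    show ?thesis
    proof (cases "v \<in> S")
      case False
      have "2 \<le> vdegree g v" using inv(2) S False by blast
      thus ?thesis
        using inv(1) card_mono[OF fin sub] False by (simp add: vdegree_old[OF g 2])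
    next
      case True
      then obtain u where u: "S = {v, u}" "u \<noteq> v"
        using S'(2) by (auto simp: card_2_iff doubleton_eq_iff)
      have "{t + 3, u} \<notin> edges g" using good_graphD(1,2)[OF g] by fastforce
      moreover have "{t + 3, u} \<in> ?T ?h v"
        using u S S'(1) by (auto simp: add_vertex_def neighbours_def insert_commute)
      ultimately have "card (insert {t + 3, u} (?T g v)) \<le> card (?T ?h v)"
        using sub by (intro card_mono fin) auto
      hence "Suc (card (?T g v)) \<le> card (?T ?h v)"
        using \<open>{t + 3, u} \<notin> edges g\<close> finite_edges_subset[OF g] by simp
      thus ?thesis
        using inv(1) good_graphD(4)[OF g 2] True by (simp add: vdegree_old[OF g 2])
    qed
  qed
qed

lemma triangle_rich_law_1:
  assumes \<delta>: "\<delta> > -1" and "g \<in> set_pmf (law 1 \<delta> t)"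
  shows "triangle_rich g \<and> card (edges g) = 2 * t + 1"
  using assms(2)
proof (induction t arbitrary: g)
  case 0
  hence g: "g = initial_graph" by simp
  have "{e. e = {1, 2} \<and> v \<in> e} = {{1, 2}}" if "v = 1 \<or> v = 2" for v :: nat using that by auto
  thus ?case unfolding g by (auto simp: triangle_rich_def initial_graph_def vdegree_def)
next
  case (Suc t)
  then obtain g' S where g': "g' \<in> set_pmf (law 1 \<delta> t)" and
    S: "S \<in> set_pmf (target_pmf 1 \<delta> t g')" and g: "g = add_vertex (t + 3) S g'"
    by (auto simp: step_pmf_eq_map_target)
  have gg: "good_graph t g'" by (rule good_graph_law[OF \<delta> g'])
  have "S \<in> edges g'" by (rule set_target_pmf_1[OF gg S])
  thus ?case
    using Suc.IH[OF g'] triangle_rich_add_vertex[OF gg, of S] good_graphD(2,3)[OF gg, of S]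
    by (simp add: g card_edges_add_vertex[OF gg])
qed

text \<open>
  The clustering coefficient is at least \<open>2 / d\<close>. The bound is the tangent of this convex function
  at \<open>d = 4\<close>, the limit of the average degree when all steps are triangle steps.
\<close>

lemma local_clustering_ge_tangent:
  assumes "2 \<le> vdegree g v" and "vdegree g v \<le> Suc (card {e \<in> edges g. e \<subseteq> neighbours g v})"
  shows "1 - real (vdegree g v) / 8 \<le> local_clustering g v"
proof -
  define d where "d = real (vdegree g v)"
  have d: "d \<ge> 2" using assms(1) by (simp add: d_def)
  have ch: "real (vdegree g v choose 2) = d * (d - 1) / 2"
    using assms(1) by (simp add: choose_two real_of_nat_div d_def of_nat_diff)
  have "0 \<le> (d - 4)\<^sup>2" by simp
  hence "1 - d / 8 \<le> 2 / d" using d by (simp add: field_simps power2_eq_square)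
  also have "2 / d = (d - 1) / (d * (d - 1) / 2)" using d by (simp add: field_simps)
  also have "\<dots> \<le> real (card {e \<in> edges g. e \<subseteq> neighbours g v}) / (d * (d - 1) / 2)"
    using assms(2) d by (intro divide_right_mono) (auto simp: d_def)
  also have "\<dots> = local_clustering g v" using assms(1) by (simp add: local_clustering_def ch)
  finally show ?thesis by (simp add: d_def)
qed

text \<open>
  Averaging the tangent bound needs only the number of edges, which is deterministic here.
\<close>

lemma avg_local_clustering_law_1:
  assumes \<delta>: "\<delta> > -1" and g: "g \<in> set_pmf (law 1 \<delta> t)" and t: "t \<ge> 1"
  shows "avg_local_clustering g \<ge> 1 / 2"
proof -
  have gg: "good_graph t g" by (rule good_graph_law[OF \<delta> g])
  have w: "triangle_rich g" and E: "card (edges g) = 2 * t + 1" using triangle_rich_law_1[OF \<delta> g] by auto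
  have V: "real (card (verts g)) = real t + 2" using good_graphD(1)[OF gg] by simp
  have "1 - real (vdegree g v) / 8 \<le> local_clustering g v" if v: "v \<in> verts g" for v
  proof (rule local_clustering_ge_tangent)
    have "vdegree g v = card (edges g)" if "\<forall>e\<in>edges g. v \<in> e"
      unfolding vdegree_def using that by (intro arg_cong[where f = card]) auto
    thus "2 \<le> vdegree g v" using w v t E by (auto simp: triangle_rich_def)
    show "vdegree g v \<le> Suc (card {e \<in> edges g. e \<subseteq> neighbours g v})"
      using w v by (auto simp: triangle_rich_def)
  qed
  hence "(\<Sum>v\<in>verts g. 1 - real (vdegree g v) / 8) \<le> (\<Sum>v\<in>verts g. local_clustering g v)"
    by (intro sum_mono)
  moreover have "(\<Sum>v\<in>verts g. 1 - real (vdegree g v) / 8) = (real t + 2) - (2 * real t + 1) / 4"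
    using handshake[OF gg] E V by (simp add: sum_subtractf flip: sum_divide_distrib of_nat_sum)
  ultimately show ?thesis by (simp add: avg_local_clustering_def V field_simps)
qed

section \<open>The density of ears\<close>

text \<open>
  The partial fractions exhibit \<open>l * A_coeff \<alpha> \<delta> l\<close> as the limit of \<open>t\<close> times the rate at which a
  vertex of degree \<open>l\<close> is hit, when the number of edges is \<open>(1 + \<alpha>) * t\<close>.
\<close>

lemma A_coeff_eq:
  assumes \<alpha>: "0 \<le> \<alpha>" and \<delta>: "-1 < \<delta>" and l: "l > 0"
  shows "real l * A_coeff \<alpha> \<delta> l =
    real l * \<alpha> / (1 + \<alpha>) + (1 - \<alpha>) * (real l + \<delta>) / (2 * (1 + \<alpha>) + \<delta>)"
proof -
  define a where "a = 1 + \<alpha>"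
  define c where "c = 2 * a + \<delta>"
  have pos: "a > 0" "c > 0" "real l > 0" using assms by (simp_all add: a_def c_def)
  have A: "A_coeff \<alpha> \<delta> l = ((a\<^sup>2 + \<delta> * \<alpha>) + \<delta> * a * (1 - \<alpha>) / real l) / (a * c)"
    by (simp add: A_coeff_def a_def c_def add.commute)
  have "real l * A_coeff \<alpha> \<delta> l = (real l * (a\<^sup>2 + \<delta> * \<alpha>) + \<delta> * a * (1 - \<alpha>)) / (a * c)"
    unfolding A using pos by (simp add: field_simps)
  also have "real l * (a\<^sup>2 + \<delta> * \<alpha>) + \<delta> * a * (1 - \<alpha>) = real l * \<alpha> * c + (1 - \<alpha>) * (real l + \<delta>) * a"
    unfolding c_def a_def by algebra
  also have "\<dots> / (a * c) = real l * \<alpha> / a + (1 - \<alpha>) * (real l + \<delta>) / c"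
    using pos by (simp add: add_divide_distrib)
  finally show ?thesis by (simp add: a_def c_def)
qed

lemma A_coeff_nonneg:
  assumes "0 \<le> \<alpha>" "\<alpha> \<le> 1" "-1 < \<delta>" "l > 0"
  shows "A_coeff \<alpha> \<delta> l \<ge> 0"
proof -
  have "real l \<ge> 1" using assms(4) by simp
  hence "0 \<le> real l + \<delta>" using assms(3) by linarith
  hence "0 \<le> real l * A_coeff \<alpha> \<delta> l"
    unfolding A_coeff_eq[OF assms(1,3,4)] using assms
    by (intro add_nonneg_nonneg[of "_ / _" "_ / _"] divide_nonneg_nonneg mult_nonneg_nonneg) auto
  thus ?thesis using assms(4) by (simp add: zero_le_mult_iff)
qed

text \<open>
  Per step, \<open>\<alpha>\<close> ears are born on average; if there are \<open>q * t\<close> ears, about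
  \<open>2 * A_coeff \<alpha> \<delta> 2 * q\<close> of them are hit. This is the \<open>q\<close> for which the difference is \<open>q\<close>.
\<close>

definition ear_density :: "real \<Rightarrow> real \<Rightarrow> real" where
  "ear_density \<alpha> \<delta> = \<alpha> / (1 + 2 * A_coeff \<alpha> \<delta> 2)"

lemma ear_density_balance:
  assumes "0 \<le> \<alpha>" "\<alpha> \<le> 1" "-1 < \<delta>"
  shows "\<alpha> - ear_density \<alpha> \<delta> = 2 * A_coeff \<alpha> \<delta> 2 * ear_density \<alpha> \<delta>"
  using A_coeff_nonneg[OF assms, of 2] by (simp add: ear_density_def field_simps)

lemma ear_density_bounds:
  assumes "0 \<le> \<alpha>" "\<alpha> \<le> 1" "-1 < \<delta>"
  shows "0 \<le> ear_density \<alpha> \<delta>" "ear_density \<alpha> \<delta> \<le> 1"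
  using A_coeff_nonneg[OF assms, of 2] assms by (simp_all add: ear_density_def divide_le_eq)

text \<open>
  The strict inequality provides the room that the law of large numbers consumes. It is an equality
  for \<open>\<alpha> = 0\<close> and for \<open>\<alpha> = 1\<close>, which is why these two cases need other arguments.
\<close>

lemma p_two_less_ear_density:
  assumes "0 < \<alpha>" "\<alpha> < 1" "-1 < \<delta>"
  shows "\<alpha> * p_two \<alpha> \<delta> < ear_density \<alpha> \<delta>"
proof -
  define a b where "a = A_coeff \<alpha> \<delta> 1" and "b = 1 + 2 * A_coeff \<alpha> \<delta> 2"
  have "a \<ge> 0" "b > 0"
    using A_coeff_nonneg[of \<alpha> \<delta> 1] A_coeff_nonneg[of \<alpha> \<delta> 2] assms by (simp_all add: a_def b_def)
  hence "(a + \<alpha>) / (a + 1) * (\<alpha> / b) < 1 * (\<alpha> / b)"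
    using assms by (intro mult_strict_right_mono) (simp_all add: divide_less_eq)
  thus ?thesis by (simp add: p_two_def ear_density_def a_def b_def add.commute mult.commute)
qed

section \<open>Second moment estimates\<close>

definition edge_dev :: "real \<Rightarrow> nat \<Rightarrow> graph \<Rightarrow> real" where
  "edge_dev \<alpha> t g = real (card (edges g)) - 1 - (1 + \<alpha>) * real t"

text \<open>
  The deviation of the number of edges from its mean is a martingale with increments bounded by one.
\<close>

lemma expectation_edge_dev_sq:
  assumes \<alpha>: "0 \<le> \<alpha>" "\<alpha> \<le> 1" and \<delta>: "-1 < \<delta>"
  shows "measure_pmf.expectation (law \<alpha> \<delta> t) (\<lambda>g. (edge_dev \<alpha> t g)\<^sup>2) \<le> real t"
proof (induction t)
  case 0
  show ?case by (simp add: edge_dev_def initial_graph_def)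
next
  case (Suc t)
  have "measure_pmf.expectation (law \<alpha> \<delta> (Suc t)) (\<lambda>g. (edge_dev \<alpha> (Suc t) g)\<^sup>2)
      \<le> measure_pmf.expectation (law \<alpha> \<delta> t) (\<lambda>g. (edge_dev \<alpha> t g)\<^sup>2 + 1)"
  proof (rule expectation_law_Suc_le[OF \<delta>])
    fix g assume g: "good_graph t g"
    let ?p = "target_pmf \<alpha> \<delta> t g" and ?B = "edge_dev \<alpha> t g"
    note int = integrable_measure_pmf_finite[OF finite_set_target_pmf[OF g \<delta>]]
    have "measure_pmf.expectation ?p (\<lambda>S. (edge_dev \<alpha> (Suc t) (add_vertex (t + 3) S g))\<^sup>2)
        \<le> measure_pmf.expectation ?p (\<lambda>S. (?B\<^sup>2 + 1) + 2 * ?B * (real (card S) - (1 + \<alpha>)))"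
    proof (rule integral_mono_AE[OF int int], unfold AE_measure_pmf_iff, rule ballI)
      fix S assume S: "S \<in> set_pmf ?p"
      note S' = target_pmf_support[OF g \<delta> S]
      define x where "x = real (card S) - (1 + \<alpha>)"
      have "edge_dev \<alpha> (Suc t) (add_vertex (t + 3) S g) = ?B + x"
        using card_edges_add_vertex[OF g S'(2)] by (simp add: edge_dev_def x_def algebra_simps)
      moreover have "\<bar>x\<bar> \<le> 1" using S'(4) \<alpha> by (auto simp: x_def)
      hence "x\<^sup>2 \<le> 1" by (simp add: abs_square_le_1)
      ultimately show "(edge_dev \<alpha> (Suc t) (add_vertex (t + 3) S g))\<^sup>2
          \<le> (?B\<^sup>2 + 1) + 2 * ?B * (real (card S) - (1 + \<alpha>))"
        by (simp add: power2_sum flip: x_def)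
    qed
    also have "\<dots> = ?B\<^sup>2 + 1"
      using expectation_card_target[OF g \<delta> \<alpha>] by (simp add: int)
    finally show "measure_pmf.expectation ?p (\<lambda>S. (edge_dev \<alpha> (Suc t) (add_vertex (t + 3) S g))\<^sup>2)
        \<le> ?B\<^sup>2 + 1" .
  qed
  also have "\<dots> \<le> real (Suc t)"
    using Suc by (simp add: integrable_measure_pmf_finite[OF finite_set_law[OF \<delta>]])
  finally show ?case .
qed

lemma expectation_abs_edge_dev:
  assumes \<alpha>: "0 \<le> \<alpha>" "\<alpha> \<le> 1" and \<delta>: "-1 < \<delta>"
  shows "measure_pmf.expectation (law \<alpha> \<delta> t) (\<lambda>g. \<bar>edge_dev \<alpha> t g\<bar>) \<le> sqrt (real t)"
proof (rule real_le_rsqrt)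
  let ?E = "measure_pmf.expectation (law \<alpha> \<delta> t)"
  note int = integrable_measure_pmf_finite[OF finite_set_law[OF \<delta>]]
  have "0 \<le> measure_pmf.variance (law \<alpha> \<delta> t) (\<lambda>g. \<bar>edge_dev \<alpha> t g\<bar>)"
    by (rule measure_pmf.variance_positive)
  also have "\<dots> = ?E (\<lambda>g. (edge_dev \<alpha> t g)\<^sup>2) - (?E (\<lambda>g. \<bar>edge_dev \<alpha> t g\<bar>))\<^sup>2"
    by (subst measure_pmf.variance_eq[OF int int]) simp
  finally show "(?E (\<lambda>g. \<bar>edge_dev \<alpha> t g\<bar>))\<^sup>2 \<le> real t"
    using expectation_edge_dev_sq[OF assms, of t] by linarith
qed

definition rate_const :: "real \<Rightarrow> real" where
  "rate_const \<delta> = 4 + 2 * (1 + \<bar>\<delta>\<bar>) / (1 + \<delta>)"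

lemma rate_const_nonneg: "-1 < \<delta> \<Longrightarrow> 0 \<le> rate_const \<delta>"
  by (simp add: rate_const_def)

text \<open>
  Both denominators of the hit rate are linear in the number of edges and at least of order \<open>t\<close>, so
  \<open>t\<close> times the rate differs from its limit by the order of the edge deviation divided by \<open>t\<close>.
\<close>

lemma hit_rate_two_approx:
  assumes g: "good_graph t g" and \<alpha>: "0 \<le> \<alpha>" "\<alpha> \<le> 1" and \<delta>: "-1 < \<delta>"
  shows "real t * \<bar>real t * hit_rate \<alpha> \<delta> t g 2 - 2 * A_coeff \<alpha> \<delta> 2\<bar>
    \<le> rate_const \<delta> * (\<bar>edge_dev \<alpha> t g\<bar> + 1)"
proof -
  define E B where "E = real (card (edges g))" and "B = edge_dev \<alpha> t g"
  define D c where "D = 2 * E + \<delta> * (real t + 2)" and "c = 2 * (1 + \<alpha>) + \<delta>"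
  define n where "n = real t + 2"
  have E: "E \<ge> n / 2" "E > 0" and D: "D \<ge> (1 + \<delta>) * n" and n: "n > 0" and tn: "real t \<le> n"
    using weight_bounds(1)[OF g] weight_bounds(2)[OF g, of \<delta>] by (auto simp: E_def D_def n_def)
  have Dn: "(1 + \<delta>) * n > 0" using \<delta> n by simp
  hence D0: "D > 0" using D by linarith
  have c: "c > 0" "2 + \<delta> \<le> c" using \<alpha> \<delta> by (simp_all add: c_def)
  have EB: "E = 1 + B + (1 + \<alpha>) * real t" by (simp add: B_def E_def edge_dev_def)
  have DB: "D = c * real t + (2 + 2 * B + 2 * \<delta>)" by (simp add: D_def EB c_def algebra_simps)
  have "real t / E - 1 / (1 + \<alpha>) = - (B + 1) / ((1 + \<alpha>) * E)"
    using E(2) \<alpha> EB by (simp add: field_simps)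
  hence "\<bar>real t / E - 1 / (1 + \<alpha>)\<bar> = \<bar>B + 1\<bar> / ((1 + \<alpha>) * E)"
    using E(2) \<alpha> by (simp add: abs_mult)
  also have "\<dots> \<le> (\<bar>B\<bar> + 1) / (1 * (n / 2))"
    using E n \<alpha> by (intro frac_le mult_mono) auto
  also have "\<dots> = 2 * (\<bar>B\<bar> + 1) / n" using n by (simp add: field_simps)
  finally have 1: "\<bar>real t / E - 1 / (1 + \<alpha>)\<bar> \<le> 2 * (\<bar>B\<bar> + 1) / n" .
  have "real t / D - 1 / c = - (2 + 2 * B + 2 * \<delta>) / (c * D)"
    using D0 c(1) DB by (simp add: field_simps)
  hence "\<bar>real t / D - 1 / c\<bar> = \<bar>2 + 2 * B + 2 * \<delta>\<bar> / (c * D)"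
    using D0 c(1) by (simp add: abs_mult)
  also have "\<dots> \<le> 2 * ((1 + \<bar>\<delta>\<bar>) * (\<bar>B\<bar> + 1)) / (c * ((1 + \<delta>) * n))"
  proof (intro frac_le mult_left_mono D)
    have "0 \<le> \<bar>\<delta>\<bar> * \<bar>B\<bar>" by simp
    thus "\<bar>2 + 2 * B + 2 * \<delta>\<bar> \<le> 2 * ((1 + \<bar>\<delta>\<bar>) * (\<bar>B\<bar> + 1))"
      unfolding distrib_left distrib_right by linarith
  qed (use c Dn in auto)
  finally have 2: "\<bar>real t / D - 1 / c\<bar> \<le> 2 * ((1 + \<bar>\<delta>\<bar>) * (\<bar>B\<bar> + 1)) / (c * ((1 + \<delta>) * n))" .
  have "real t * hit_rate \<alpha> \<delta> t g 2 - 2 * A_coeff \<alpha> \<delta> 2 =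
      2 * \<alpha> * (real t / E - 1 / (1 + \<alpha>)) + (1 - \<alpha>) * (2 + \<delta>) * (real t / D - 1 / c)"
  proof -
    have "hit_rate \<alpha> \<delta> t g 2 = 2 * \<alpha> / E + (1 - \<alpha>) * (2 + \<delta>) / D"
      by (simp add: hit_rate_def E_def D_def mult.commute)
    moreover have "2 * A_coeff \<alpha> \<delta> 2 = 2 * \<alpha> / (1 + \<alpha>) + (1 - \<alpha>) * (2 + \<delta>) / c"
      using A_coeff_eq[OF \<alpha>(1) \<delta>, of 2] by (simp add: c_def)
    moreover have "real t * (x / E + w / D) - (x / a + w / c)
        = x * (real t / E - 1 / a) + w * (real t / D - 1 / c)" for x w a :: real
      by (simp add: algebra_simps)
    ultimately show ?thesis by simp
  qed
  also have "\<bar>\<dots>\<bar> \<le> 2 * \<alpha> * \<bar>real t / E - 1 / (1 + \<alpha>)\<bar> + (1 - \<alpha>) * (2 + \<delta>) * \<bar>real t / D - 1 / c\<bar>"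
    using \<alpha> \<delta> by (intro order.trans[OF abs_triangle_ineq] add_mono) (simp_all add: abs_mult)
  also have "\<dots> \<le> 2 * 1 * (2 * (\<bar>B\<bar> + 1) / n)
      + 1 * c * (2 * ((1 + \<bar>\<delta>\<bar>) * (\<bar>B\<bar> + 1)) / (c * ((1 + \<delta>) * n)))"
    using \<alpha> \<delta> c by (intro add_mono mult_mono 1 2) auto
  also have "\<dots> = rate_const \<delta> * (\<bar>B\<bar> + 1) / n"
  proof -
    define d where "d = 1 + \<delta>"
    have "d > 0" using \<delta> by (simp add: d_def)
    thus ?thesis using c(1) n unfolding rate_const_def d_def[symmetric]
      by (simp add: field_simps)
  qed
  finally have "real t * \<bar>real t * hit_rate \<alpha> \<delta> t g 2 - 2 * A_coeff \<alpha> \<delta> 2\<bar>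
      \<le> n * (rate_const \<delta> * (\<bar>B\<bar> + 1) / n)"
    using tn by (intro mult_mono) auto
  thus ?thesis using n by (simp add: B_def)
qed

text \<open>
  Only a shortage of ears matters. Taking the positive part makes the one-sided drift estimate
  sufficient, although the true number of ears may grow faster than \<open>ear_density \<alpha> \<delta> * t\<close>.
\<close>

definition deficit :: "real \<Rightarrow> real \<Rightarrow> nat \<Rightarrow> graph \<Rightarrow> real" where
  "deficit \<alpha> \<delta> t g = max 0 (ear_density \<alpha> \<delta> * real t - real (card (ears g)))"

text \<open>
  A shortage \<open>y\<close> of ears reduces the loss of ears, hence the drift pushes the squared deficit
  down, up to the error \<open>2 * y * q * \<bar>t * r - 2 * A_coeff \<alpha> \<delta> 2\<bar>\<close> from the fluctuating number of
  edges, with \<open>r\<close> the hit rate of an ear. As \<open>y \<le> q * t\<close>, this error is of the order of the edge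
  deviation. The bounded increments contribute the square of at most three.
\<close>

lemma deficit_drift:
  assumes g: "good_graph t g" and \<alpha>: "0 \<le> \<alpha>" "\<alpha> \<le> 1" and \<delta>: "-1 < \<delta>"
  shows "measure_pmf.expectation (target_pmf \<alpha> \<delta> t g)
      (\<lambda>S. (deficit \<alpha> \<delta> (Suc t) (add_vertex (t + 3) S g))\<^sup>2)
    \<le> (deficit \<alpha> \<delta> t g)\<^sup>2 + (2 * rate_const \<delta> + 9) * (\<bar>edge_dev \<alpha> t g\<bar> + 1)"
proof -
  let ?p = "target_pmf \<alpha> \<delta> t g"
  define q where "q = ear_density \<alpha> \<delta>"
  define X where "X = real (card (ears g))"
  define y where "y = deficit \<alpha> \<delta> t g"
  define r where "r = hit_rate \<alpha> \<delta> t g 2"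
  define \<Delta> where "\<Delta> S = real (card S) - 1 - real (card (S \<inter> ears g)) - q" for S
  have q: "0 \<le> q" "q \<le> 1" using ear_density_bounds[OF \<alpha> \<delta>] by (simp_all add: q_def)
  have y: "y = max 0 (q * real t - X)" by (simp add: y_def deficit_def q_def X_def)
  note int = integrable_measure_pmf_finite[OF finite_set_target_pmf[OF g \<delta>]]
  have "measure_pmf.expectation ?p (\<lambda>S. (deficit \<alpha> \<delta> (Suc t) (add_vertex (t + 3) S g))\<^sup>2)
      \<le> measure_pmf.expectation ?p (\<lambda>S. (y\<^sup>2 + 9) - 2 * y * \<Delta> S)"
  proof (rule integral_mono_AE[OF int int], unfold AE_measure_pmf_iff, rule ballI)
    fix S assume S: "S \<in> set_pmf ?p"
    note S' = target_pmf_support[OF g \<delta> S]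
    \<comment> \<open>the increment minus \<open>q\<close> lies between \<open>0 - 2 - 1\<close> and \<open>1\<close>\<close>
    have "card (S \<inter> ears g) \<le> card S" using S'(3) by (intro card_mono) auto
    hence "\<bar>\<Delta> S\<bar> \<le> \<bar>3\<bar>" using S'(4) q by (auto simp: \<Delta>_def)
    hence "(\<Delta> S)\<^sup>2 \<le> 3\<^sup>2" by (simp only: abs_le_square_iff)
    have "deficit \<alpha> \<delta> (Suc t) (add_vertex (t + 3) S g) \<le> \<bar>y - \<Delta> S\<bar>"
    proof -
      have "q * real (Suc t) = q * real t + q" by (simp add: algebra_simps)
      thus ?thesis
        using card_ears_add_vertex[OF g \<delta> S]
        unfolding deficit_def y X_def \<Delta>_def q_def[symmetric] by linarith
    qed
    hence "(deficit \<alpha> \<delta> (Suc t) (add_vertex (t + 3) S g))\<^sup>2 \<le> (y - \<Delta> S)\<^sup>2"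
      by (intro abs_le_square_iff[THEN iffD1]) (simp add: deficit_def)
    also have "\<dots> \<le> (y\<^sup>2 + 9) - 2 * y * \<Delta> S"
      using \<open>(\<Delta> S)\<^sup>2 \<le> 3\<^sup>2\<close> by (simp add: power2_diff)
    finally show "(deficit \<alpha> \<delta> (Suc t) (add_vertex (t + 3) S g))\<^sup>2 \<le> (y\<^sup>2 + 9) - 2 * y * \<Delta> S" .
  qed
  also have "\<dots> = y\<^sup>2 + 9 - 2 * y * (\<alpha> - X * r - q)"
  proof -
    have "measure_pmf.expectation ?p (\<lambda>S. real (card (S \<inter> ears g))) = X * r"
      using vdegree_ear[OF g] by (simp add: expectation_card_hit[OF g \<delta> \<alpha> ears_subset] X_def r_def)
    hence "measure_pmf.expectation ?p \<Delta> = \<alpha> - X * r - q"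
      unfolding \<Delta>_def using expectation_card_target[OF g \<delta> \<alpha>] by (simp add: int)
    thus ?thesis by (simp add: int)
  qed
  also have "\<dots> \<le> y\<^sup>2 + (9 + 2 * (rate_const \<delta> * (\<bar>edge_dev \<alpha> t g\<bar> + 1)))"
  proof -
    define a where "a = 2 * A_coeff \<alpha> \<delta> 2"
    have bal: "\<alpha> - q = a * q" using ear_density_balance[OF \<alpha> \<delta>] by (simp add: q_def a_def)
    have r: "r \<ge> 0"
    proof -
      have "0 \<le> (1 + \<delta>) * (real t + 2)" using \<delta> by simp
      hence "0 \<le> 2 * real (card (edges g)) + \<delta> * (real t + 2)"
        using weight_bounds(2)[OF g, of \<delta>] by linarith
      thus ?thesis using \<alpha> \<delta> by (simp add: r_def hit_rate_def)
    qed
    have y0: "0 \<le> y" and yt: "y \<le> q * real t" using q by (auto simp: y X_def)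
    have "- (y * (\<alpha> - X * r - q)) \<le> y * (q * \<bar>real t * r - a\<bar>)"
    proof (cases "y = 0")
      case False
      hence "X \<le> q * real t" by (auto simp: y split: if_splits)
      hence "X * r \<le> q * real t * r" using r by (rule mult_right_mono)
      hence "- (\<alpha> - X * r - q) \<le> q * (real t * r - a)" using bal by (simp add: algebra_simps)
      also have "\<dots> \<le> q * \<bar>real t * r - a\<bar>" using q by (intro mult_left_mono) auto
      finally have "y * - (\<alpha> - X * r - q) \<le> y * (q * \<bar>real t * r - a\<bar>)"
        by (rule mult_left_mono[OF _ y0])
      thus ?thesis by (simp only: mult_minus_right)
    qed simp
    also have "\<dots> \<le> (1 * real t) * (1 * \<bar>real t * r - a\<bar>)"
      using q yt y0 by (intro mult_mono order.trans[OF yt]) auto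
    also have "\<dots> \<le> rate_const \<delta> * (\<bar>edge_dev \<alpha> t g\<bar> + 1)"
      using hit_rate_two_approx[OF g \<alpha> \<delta>] by (simp add: r_def a_def)
    finally show ?thesis by simp
  qed
  also have "\<dots> \<le> y\<^sup>2 + (2 * rate_const \<delta> + 9) * (\<bar>edge_dev \<alpha> t g\<bar> + 1)"
    by (simp add: algebra_simps)
  finally show ?thesis by (simp add: y_def)
qed

text \<open>
  The edge deviation is of order \<open>sqrt t\<close>, so summing the drift bound gives \<open>t powr (3 / 2)\<close>, which
  is small compared with \<open>t\<^sup>2\<close>.
\<close>

lemma expectation_deficit_sq:
  assumes \<alpha>: "0 \<le> \<alpha>" "\<alpha> \<le> 1" and \<delta>: "-1 < \<delta>"
  shows "measure_pmf.expectation (law \<alpha> \<delta> t) (\<lambda>g. (deficit \<alpha> \<delta> t g)\<^sup>2)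
    \<le> real t * ((2 * rate_const \<delta> + 9) * (sqrt (real t) + 1))"
proof (induction t)
  case 0
  show ?case by (simp add: deficit_def)
next
  case (Suc t)
  define K where "K = 2 * rate_const \<delta> + 9"
  have K: "K \<ge> 0" using rate_const_nonneg[OF \<delta>] by (simp add: K_def)
  let ?E = "measure_pmf.expectation (law \<alpha> \<delta> t)"
  note int = integrable_measure_pmf_finite[OF finite_set_law[OF \<delta>]]
  have "measure_pmf.expectation (law \<alpha> \<delta> (Suc t)) (\<lambda>g. (deficit \<alpha> \<delta> (Suc t) g)\<^sup>2)
      \<le> ?E (\<lambda>g. (deficit \<alpha> \<delta> t g)\<^sup>2 + K * (\<bar>edge_dev \<alpha> t g\<bar> + 1))"
    unfolding K_def by (intro expectation_law_Suc_le[OF \<delta>] deficit_drift \<alpha> \<delta>)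
  also have "\<dots> = ?E (\<lambda>g. (deficit \<alpha> \<delta> t g)\<^sup>2) + K * (?E (\<lambda>g. \<bar>edge_dev \<alpha> t g\<bar>) + 1)"
    by (simp add: int)
  also have "\<dots> \<le> real t * (K * (sqrt (real t) + 1)) + K * (sqrt (real t) + 1)"
    using Suc K expectation_abs_edge_dev[OF \<alpha> \<delta>, of t]
    by (intro add_mono mult_left_mono) (auto simp: K_def)
  also have "\<dots> = real (Suc t) * (K * (sqrt (real t) + 1))" by (simp add: algebra_simps)
  also have "\<dots> \<le> real (Suc t) * (K * (sqrt (real (Suc t)) + 1))"
    using K by (intro mult_left_mono add_mono) auto
  finally show ?case by (simp add: K_def)
qed

lemma prob_few_ears_tendsto_0:
  assumes \<alpha>: "0 \<le> \<alpha>" "\<alpha> \<le> 1" and \<delta>: "-1 < \<delta>" and c: "c < ear_density \<alpha> \<delta>"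
  shows "(\<lambda>t. measure_pmf.prob (law \<alpha> \<delta> t) {g. real (card (ears g)) < c * (real t + 2)}) \<longlonglongrightarrow> 0"
proof (rule tendsto_sandwich[OF _ _ tendsto_const])
  define \<epsilon> K where "\<epsilon> = ear_density \<alpha> \<delta> - c" and "K = 2 * rate_const \<delta> + 9"
  have \<epsilon>: "\<epsilon> > 0" using c by (simp add: \<epsilon>_def)
  \<comment> \<open>fewer than \<open>c * (t + 2)\<close> ears amount to a deficit larger than \<open>gap t\<close>\<close>
  define gap where "gap t = \<epsilon> * real t - 2 * c" for t
  have "\<forall>\<^sub>F t in sequentially. gap t > 0"
    unfolding gap_def using \<epsilon> by real_asymp
  thus "\<forall>\<^sub>F t in sequentially.
      measure_pmf.prob (law \<alpha> \<delta> t) {g. real (card (ears g)) < c * (real t + 2)}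
      \<le> real t * (K * (sqrt (real t) + 1)) / (gap t)\<^sup>2"
  proof eventually_elim
    case (elim t)
    let ?p = "law \<alpha> \<delta> t"
    have "measure_pmf.prob ?p {g. real (card (ears g)) < c * (real t + 2)}
        \<le> measure_pmf.prob ?p {g \<in> space ?p. (deficit \<alpha> \<delta> t g)\<^sup>2 \<ge> (gap t)\<^sup>2}"
    proof (intro measure_pmf.finite_measure_mono subsetI)
      fix g assume "g \<in> {g. real (card (ears g)) < c * (real t + 2)}"
      hence "gap t \<le> deficit \<alpha> \<delta> t g" by (simp add: gap_def \<epsilon>_def deficit_def algebra_simps)
      thus "g \<in> {g \<in> space ?p. (deficit \<alpha> \<delta> t g)\<^sup>2 \<ge> (gap t)\<^sup>2}"
        using elim by (simp add: power_mono)
    qed simp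
    also have "\<dots> \<le> measure_pmf.expectation ?p (\<lambda>g. (deficit \<alpha> \<delta> t g)\<^sup>2) / (gap t)\<^sup>2"
      using elim
      by (intro integral_Markov_inequality_measure[where A = "{}"]
          integrable_measure_pmf_finite[OF finite_set_law[OF \<delta>]]) auto
    also have "\<dots> \<le> real t * (K * (sqrt (real t) + 1)) / (gap t)\<^sup>2"
      using expectation_deficit_sq[OF \<alpha> \<delta>] by (intro divide_right_mono) (auto simp: K_def)
    finally show ?case .
  qed
  show "(\<lambda>t. real t * (K * (sqrt (real t) + 1)) / (gap t)\<^sup>2) \<longlonglongrightarrow> 0"
    unfolding gap_def using \<epsilon> by real_asymp
qed simp

section \<open>The average local clustering coefficient\<close>

theorem theorem3p2:
  fixes M :: "'w measure" and G :: "nat \<Rightarrow> 'w \<Rightarrow> graph" and \<alpha> \<delta> :: real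
  assumes "0 \<le> \<alpha>" and "\<alpha> \<le> 1" and "-1 < \<delta>"
    and "triangle_attachment_process M \<alpha> \<delta> G"
  shows "(\<lambda>t. \<P>(\<omega> in M. avg_local_clustering (G t \<omega>) \<ge> \<alpha> * p_two \<alpha> \<delta>)) \<longlonglongrightarrow> 1"
proof -
  note \<delta> = assms(3)
  define c where "c = \<alpha> * p_two \<alpha> \<delta>"
  let ?prob = "\<lambda>t. measure_pmf.prob (law \<alpha> \<delta> t)"
  have "(\<lambda>t. ?prob t {g. avg_local_clustering g \<ge> c}) \<longlonglongrightarrow> 1"
  proof -
    consider "\<alpha> = 0" | "\<alpha> = 1" | "0 < \<alpha>" "\<alpha> < 1" using assms(1,2) by linarith
    thus ?thesis
    proof cases
      case 1
      thus ?thesis by (simp add: c_def avg_local_clustering_nonneg)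
    next
      case 2
      have "A_coeff 1 \<delta> 2 = 1 / 2" using A_coeff_eq[OF _ \<delta>, of 1 2] by simp
      moreover have "A_coeff 1 \<delta> 1 \<ge> 0" by (rule A_coeff_nonneg) (use \<delta> in auto)
      ultimately have c: "c = 1 / 2" using 2 by (simp add: c_def p_two_def)
      have "?prob t {g. avg_local_clustering g \<ge> c} = 1" if "t \<ge> 1" for t
      proof (subst measure_pmf.prob_eq_1)
        show "AE g in law \<alpha> \<delta> t. g \<in> {g. avg_local_clustering g \<ge> c}"
          unfolding AE_measure_pmf_iff 2 c
          by (intro ballI CollectI avg_local_clustering_law_1[OF \<delta> _ that])
      qed simp
      thus ?thesis
        by (intro tendsto_eventually eventually_sequentiallyI[of 1])
    next
      case 3
      have lower: "1 - ?prob t {g. real (card (ears g)) < c * (real t + 2)}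
          \<le> ?prob t {g. avg_local_clustering g \<ge> c}" for t
      proof -
        have "?prob t {g. \<not> avg_local_clustering g \<ge> c}
            \<le> ?prob t {g. real (card (ears g)) < c * (real t + 2)}"
        proof (rule measure_pmf.finite_measure_mono_AE)
          show "AE g in law \<alpha> \<delta> t. g \<in> {g. \<not> avg_local_clustering g \<ge> c} \<longrightarrow>
              g \<in> {g. real (card (ears g)) < c * (real t + 2)}"
            unfolding AE_measure_pmf_iff
          proof (intro ballI impI CollectI)
            fix g assume "g \<in> set_pmf (law \<alpha> \<delta> t)" and "g \<in> {g. \<not> avg_local_clustering g \<ge> c}"
            hence "real (card (ears g)) / (real t + 2) < c"
              using avg_local_clustering_ge_ears[OF good_graph_law[OF \<delta>], of g \<alpha> t] by simp
            thus "real (card (ears g)) < c * (real t + 2)" by (simp add: divide_less_eq)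
          qed
        qed simp
        moreover have "?prob t {g. \<not> avg_local_clustering g \<ge> c} =
            1 - ?prob t {g. avg_local_clustering g \<ge> c}"
          using measure_pmf.prob_compl[of "{g. avg_local_clustering g \<ge> c}" "law \<alpha> \<delta> t"]
          by (simp add: Compl_eq_Diff_UNIV[symmetric] Collect_neg_eq)
        ultimately show ?thesis by linarith
      qed
      have "c < ear_density \<alpha> \<delta>" unfolding c_def by (rule p_two_less_ear_density[OF 3 \<delta>])
      from tendsto_diff[OF tendsto_const prob_few_ears_tendsto_0[OF assms(1,2) \<delta> this], of 1]
      have "(\<lambda>t. 1 - ?prob t {g. real (card (ears g)) < c * (real t + 2)}) \<longlonglongrightarrow> 1" by simp
      from tendsto_sandwich[OF _ _ this tendsto_const] show ?thesis using lower by simp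
    qed
  qed
  thus ?thesis
    unfolding c_def
    by (simp only: triangle_attachment_process.prob_G_law[OF assms(4) \<delta>,
        where P = "\<lambda>g. avg_local_clustering g \<ge> \<alpha> * p_two \<alpha> \<delta>"])
qed

end
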